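(* Let $F$ be a finite field, $\Gamma$ a nonempty set, $\varphi:\Gamma\to\Gamma$ a self-map, $\mathfrak{w}=(\mathfrak{w}_\alpha)_{\alpha\in\Gamma}\in F^\Gamma$, and suppose that $\sigma_{\varphi,\mathfrak{w}}:F^\Gamma\to F^\Gamma$, $\sigma_{\varphi,\mathfrak{w}}((x_\alpha)_{\alpha\in\Gamma})=(\mathfrak{w}_\alpha x_{\varphi(\alpha)})_{\alpha\in\Gamma}$, is of finite fibre. Let $\mathrm{supp}(\mathfrak{w})=\{\alpha\in\Gamma:\mathfrak{w}_\alpha\neq0\}$ and $\Lambda=\bigcap\{\varphi^{-n}(\mathrm{supp}(\mathfrak{w})):n\geq0\}$ (so $\varphi(\Lambda)\subseteq\Lambda$). Then $$\mathrm{ent}_{\mathrm{cset}}(\sigma_{\varphi,\mathfrak{w}})=\mathrm{ent}_{\mathrm{cset}}(\sigma_{\varphi\restriction_\Lambda,\mathfrak{w}^\Lambda})=\mathrm{ent}_{\mathrm{cset}}(\sigma_{\varphi\restriction_\Lambda}),$$ and this common value equals $+\infty$ if $\varphi$ has a non-quasi-periodic point in $\Lambda$; equals $+\infty$ if $\mathrm{Per}(\varphi)\cap\Lambda\neq\varnothing$ and $\sup\{\mathrm{per}(\alpha):\alpha\in\mathrm{Per}(\varphi)\cap\Lambda\}=+\infty$; and equals $0$ otherwise.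
   Context: A map is of finite fibre if the preimage of every point is finite. For a self-map $f:A\to A$, an $f$-anti-orbit is a sequence $\{a_n\}_{n\geq1}$ in $A$ with $f(a_{n+1})=a_n$ for all $n\geq1$; it is one-to-one if its terms are pairwise distinct. $\mathsf{a}(f)$ is the supremum (in $\{0,1,2,\dots\}\cup\{+\infty\}$) of $\{0\}$ together with all $n\geq1$ such that there exist $n$ pairwise disjoint one-to-one $f$-anti-orbits in $A$. For a finite fibre $f:A\to A$ the contravariant set-theoretical entropy is $\mathrm{ent}_{\mathrm{cset}}(f)=\mathsf{a}(f)$. $\mathrm{Per}(\varphi)=\{\alpha:\exists n\geq1,\ \varphi^n(\alpha)=\alpha\}$, and $\mathrm{per}(\alpha)=\min\{n\geq1:\varphi^n(\alpha)=\alpha\}$ for $\alpha\in\mathrm{Per}(\varphi)$. A point $\alpha$ is quasi-periodic for $\varphi$ if $\varphi^n(\alpha)=\varphi^m(\alpha)$ for some $m>n\geq1$. $\mathfrak{w}^\Lambda=(\mathfrak{w}_\alpha)_{\alpha\in\Lambda}$; $\sigma_{\varphi\restriction_\Lambda,\mathfrak{w}^\Lambda}:F^\Lambda\to F^\Lambda$ is $(x_\alpha)_{\alpha\in\Lambda}\mapsto(\mathfrak{w}_\alpha x_{\varphi(\alpha)})_{\alpha\in\Lambda}$, and $\sigma_{\varphi\restriction_\Lambda}:F^\Lambda\to F^\Lambda$ is $(x_\alpha)_{\alpha\in\Lambda}\mapsto(x_{\varphi(\alpha)})_{\alpha\in\Lambda}$; under the stated hypotheses these maps are also of finite fibre. If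 $\Lambda=\varnothing$, $F^\Lambda$ is a one-point set and these maps have entropy $0$. *)

theory Defs
  imports "HOL-Library.FuncSet" "HOL-Library.Extended_Nat" "HOL-Library.Disjoint_Sets"
begin

text \<open>A self-map of a set is a function on the ambient type together with its carrier.\<close>

definition finite_fibre :: "'b set \<Rightarrow> ('b \<Rightarrow> 'b) \<Rightarrow> bool" where
  "finite_fibre A f \<longleftrightarrow> f \<in> A \<rightarrow> A \<and> (\<forall>b\<in>A. finite {a \<in> A. f a = b})"

text \<open>Sequences are indexed by the integers \<open>n \<ge> 1\<close>; the value at \<open>0\<close> is irrelevant.\<close>

definition anti_orbit :: "'b set \<Rightarrow> ('b \<Rightarrow> 'b) \<Rightarrow> (nat \<Rightarrow> 'b) \<Rightarrow> bool" where
  "anti_orbit A f a \<longleftrightarrow> (\<forall>n\<ge>1. a n \<in> A \<and> f (a (Suc n)) = a n)"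

definition one_to_one_anti_orbit :: "'b set \<Rightarrow> ('b \<Rightarrow> 'b) \<Rightarrow> (nat \<Rightarrow> 'b) \<Rightarrow> bool" where
  "one_to_one_anti_orbit A f a \<longleftrightarrow> anti_orbit A f a \<and> inj_on a {1..}"

definition anti_orbit_number :: "'b set \<Rightarrow> ('b \<Rightarrow> 'b) \<Rightarrow> enat" where
  "anti_orbit_number A f = Sup ({0} \<union> {enat n | n. n \<ge> 1 \<and>
     (\<exists>s :: nat \<Rightarrow> nat \<Rightarrow> 'b. (\<forall>i<n. one_to_one_anti_orbit A f (s i)) \<and>
        disjoint_family_on (\<lambda>i. s i ` {1..}) {..<n})})"

text \<open>The entropy is meaningful only when \<open>finite_fibre A f\<close> holds.\<close>

definition ent_cset :: "'b set \<Rightarrow> ('b \<Rightarrow> 'b) \<Rightarrow> enat" where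
  "ent_cset A f = anti_orbit_number A f"

text \<open>\<open>F\<^sup>\<Gamma>\<close> consists of the functions that are \<^const>\<open>undefined\<close> outside \<open>\<Gamma>\<close>, so that equality
  of functions is equality of families indexed by \<open>\<Gamma>\<close>; \<open>F\<close> is the whole type.\<close>

abbreviation families :: "'a set \<Rightarrow> ('a \<Rightarrow> 'f) set" where
  "families \<Gamma> \<equiv> \<Gamma> \<rightarrow>\<^sub>E UNIV"

definition gen_shift :: "'a set \<Rightarrow> ('a \<Rightarrow> 'a) \<Rightarrow> ('a \<Rightarrow> 'f) \<Rightarrow> ('a \<Rightarrow> 'f)" where
  "gen_shift \<Gamma> \<phi> x = (\<lambda>\<alpha>\<in>\<Gamma>. x (\<phi> \<alpha>))"

definition weighted_gen_shift ::
    "'a set \<Rightarrow> ('a \<Rightarrow> 'a) \<Rightarrow> ('a \<Rightarrow> 'f::field) \<Rightarrow> ('a \<Rightarrow> 'f) \<Rightarrow> ('a \<Rightarrow> 'f)" where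
  "weighted_gen_shift \<Gamma> \<phi> w x = (\<lambda>\<alpha>\<in>\<Gamma>. w \<alpha> * x (\<phi> \<alpha>))"

definition weight_supp :: "'a set \<Rightarrow> ('a \<Rightarrow> 'f::field) \<Rightarrow> 'a set" where
  "weight_supp \<Gamma> w = {\<alpha> \<in> \<Gamma>. w \<alpha> \<noteq> 0}"

definition Per :: "'a set \<Rightarrow> ('a \<Rightarrow> 'a) \<Rightarrow> 'a set" where
  "Per \<Gamma> \<phi> = {\<alpha> \<in> \<Gamma>. \<exists>n\<ge>1. (\<phi> ^^ n) \<alpha> = \<alpha>}"

definition per :: "('a \<Rightarrow> 'a) \<Rightarrow> 'a \<Rightarrow> nat" where
  "per \<phi> \<alpha> = (LEAST n. n \<ge> 1 \<and> (\<phi> ^^ n) \<alpha> = \<alpha>)"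

definition quasi_periodic :: "('a \<Rightarrow> 'a) \<Rightarrow> 'a \<Rightarrow> bool" where
  "quasi_periodic \<phi> \<alpha> \<longleftrightarrow> (\<exists>n m. n \<ge> 1 \<and> m > n \<and> (\<phi> ^^ n) \<alpha> = (\<phi> ^^ m) \<alpha>)"

end

theory Submission
  imports Defs "HOL-Library.Infinite_Set"
begin

text \<open>
  An anti-orbit satisfies \<open>x n \<alpha> = w \<alpha> * x (n + 1) (\<phi> \<alpha>)\<close>. Iterating this, \<open>x n\<close> vanishes outside
  \<open>\<Lambda>\<close>, and on \<open>\<Lambda>\<close> the value at \<open>\<alpha>\<close> is determined by later values along the trajectory of
  \<open>\<alpha>\<close>. If all these trajectories end in cycles of length at most \<open>N\<close>, then every anti-orbit is
  periodic in \<open>n\<close> with period \<open>N! (|F| - 1)\<close>, since the product of the weights over a cycle is a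
  unit of \<open>F\<close>; so no anti-orbit is one-to-one. Conversely, the support of an anti-orbit may be any
  union of grand orbits of the map \<open>(n, \<alpha>) \<mapsto> (n + 1, \<phi> \<alpha>)\<close> on \<open>\<nat> \<times> \<Lambda>\<close>. A
  non-quasi-periodic point, or cycles of unbounded length, provide infinitely many pairwise
  disjoint one-to-one anti-orbits that are told apart by their supports alone. The criterion only
  involves \<open>\<phi>\<close> on \<open>\<Lambda>\<close>, so it gives the same value for all three shifts.
\<close>

section \<open>Criteria for the extreme values of the anti-orbit number\<close>

text \<open>Injectivity in the pair \<open>(i, n)\<close> contains both one-to-oneness of each
  \<open>s i\<close> and disjointness of different ones, so every finite count is attained.\<close>

lemma anti_orbit_number_infinity:
  fixes s :: "nat \<Rightarrow> nat \<Rightarrow> 'b"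
  assumes orb: "\<And>i. anti_orbit A f (s i)"
    and inj: "\<And>i j n m. \<lbrakk>n \<ge> 1; m \<ge> 1; s i n = s j m\<rbrakk> \<Longrightarrow> i = j \<and> n = m"
  shows "anti_orbit_number A f = \<infinity>"
proof -
  have "one_to_one_anti_orbit A f (s i)" for i
    using orb inj by (auto simp: one_to_one_anti_orbit_def inj_on_def)
  moreover have "disjoint_family_on (\<lambda>i. s i ` {1..}) {..<n}" for n
    using inj by (fastforce simp: disjoint_family_on_def)
  ultimately have "enat n \<le> anti_orbit_number A f" if "n \<ge> 1" for n
    unfolding anti_orbit_number_def using that by (intro Sup_upper) blast
  then have "enat n \<le> anti_orbit_number A f" for n
    by (cases "n = 0") (auto simp flip: zero_enat_def)
  \<comment> \<open>A finite value v would have to be at least v + 1.\<close>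
  from this[of "Suc (the_enat (anti_orbit_number A f))"] show ?thesis
    by (cases "anti_orbit_number A f") auto
qed

lemma anti_orbit_number_zero:
  assumes "\<And>a. anti_orbit A f a \<Longrightarrow> \<not> inj_on a {1..}"
  shows "anti_orbit_number A f = 0"
proof -
  have "{enat n | n. n \<ge> 1 \<and>
     (\<exists>s :: nat \<Rightarrow> nat \<Rightarrow> 'a. (\<forall>i<n. one_to_one_anti_orbit A f (s i)) \<and>
        disjoint_family_on (\<lambda>i. s i ` {1..}) {..<n})} = {}"
    using assms by (force simp: one_to_one_anti_orbit_def)
  then show ?thesis
    unfolding anti_orbit_number_def by (simp only:) simp
qed

section \<open>Units of a finite field; iterates and periods of a self-map\<close>

text \<open>Multiplication by \<open>a\<close> permutes the nonzero elements; comparing the products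
  before and after leaves the power of \<open>a\<close> as a factor 1.\<close>

lemma finite_field_power_eq_1:
  fixes a :: "'f :: {field, finite}"
  assumes "a \<noteq> 0"
  shows "a ^ card (UNIV - {0 :: 'f}) = 1"
proof -
  have "bij_betw ((*) a) (UNIV - {0}) (UNIV - {0})"
    by (rule bij_betwI[where g = "(*) (inverse a)"]) (use assms in auto)
  then have "(\<Prod>b\<in>UNIV - {0}. a * b) = \<Prod>(UNIV - {0})"
    by (rule prod.reindex_bij_betw)
  moreover have "\<Prod>(UNIV - {0 :: 'f}) \<noteq> 0"
    by simp
  ultimately show ?thesis
    by (simp add: prod.distrib)
qed

lemma funpow_per:
  assumes "\<alpha> \<in> Per \<Gamma> \<phi>"
  shows "per \<phi> \<alpha> \<ge> 1" "(\<phi> ^^ per \<phi> \<alpha>) \<alpha> = \<alpha>"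
proof -
  have "\<exists>n. n \<ge> 1 \<and> (\<phi> ^^ n) \<alpha> = \<alpha>"
    using assms by (auto simp: Per_def)
  from LeastI_ex[OF this] show "per \<phi> \<alpha> \<ge> 1" "(\<phi> ^^ per \<phi> \<alpha>) \<alpha> = \<alpha>"
    by (auto simp: per_def)
qed

lemma funpow_mult_fixpoint:
  assumes "(\<phi> ^^ p) \<alpha> = \<alpha>"
  shows "(\<phi> ^^ (p * k)) \<alpha> = \<alpha>"
  by (induction k) (simp_all add: funpow_add assms)

lemma funpow_eq_imp_per_dvd:
  assumes "\<alpha> \<in> Per \<Gamma> \<phi>" "(\<phi> ^^ n) \<alpha> = \<alpha>"
  shows "per \<phi> \<alpha> dvd n"
proof (rule ccontr)
  let ?p = "per \<phi> \<alpha>"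
  assume "\<not> ?p dvd n"
  then have "n mod ?p \<ge> 1" "n mod ?p < ?p"
    using funpow_per(1)[OF assms(1)] by (auto simp: dvd_eq_mod_eq_0)
  moreover have "(\<phi> ^^ (n mod ?p)) \<alpha> = \<alpha>"
  proof -
    have "(\<phi> ^^ n) \<alpha> = (\<phi> ^^ (n mod ?p)) ((\<phi> ^^ (?p * (n div ?p))) \<alpha>)"
      by (metis funpow_add comp_apply mod_mult_div_eq)
    then show ?thesis
      using funpow_mult_fixpoint[OF funpow_per(2)[OF assms(1)]] assms(2) by simp
  qed
  ultimately show False
    using not_less_Least[of "n mod ?p" "\<lambda>n. n \<ge> 1 \<and> (\<phi> ^^ n) \<alpha> = \<alpha>"] by (auto simp: per_def)
qed

text \<open>Going on around its cycle, \<alpha> returns to itself and hence lies on the trajectory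
  of \<beta>. The iterate by the period of \<beta> fixes \<beta> and commutes with \<phi>, so it
  fixes \<alpha> too. Cycles of different periods therefore never meet.\<close>

lemma per_dvd_of_meet:
  assumes "\<alpha> \<in> Per \<Gamma> \<phi>" "\<beta> \<in> Per \<Gamma> \<phi>" "(\<phi> ^^ i) \<alpha> = (\<phi> ^^ j) \<beta>"
  shows "per \<phi> \<alpha> dvd per \<phi> \<beta>"
proof -
  let ?p = "per \<phi> \<alpha>" and ?q = "per \<phi> \<beta>"
  obtain d where d: "(\<phi> ^^ d) ((\<phi> ^^ i) \<alpha>) = \<alpha>"
  proof
    have "?p * i - i + i = ?p * i"
      using funpow_per(1)[OF assms(1)] by simp
    then show "(\<phi> ^^ (?p * i - i)) ((\<phi> ^^ i) \<alpha>) = \<alpha>"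
      using funpow_mult_fixpoint[OF funpow_per(2)[OF assms(1)], of i]
      by (metis comp_apply funpow_add)
  qed
  have "(\<phi> ^^ ?q) \<alpha> = (\<phi> ^^ ?q) ((\<phi> ^^ (d + j)) \<beta>)"
    using d assms(3) by (simp add: funpow_add)
  also have "\<dots> = (\<phi> ^^ (d + j)) ((\<phi> ^^ ?q) \<beta>)"
    by (metis comp_apply funpow_add add.commute)
  also have "\<dots> = \<alpha>"
    using d assms(3) funpow_per(2)[OF assms(2)] by (simp add: funpow_add)
  finally show ?thesis
    by (rule funpow_eq_imp_per_dvd[OF assms(1)])
qed

text \<open>On a cycle \<phi> is invertible: \<open>?p * i - i\<close> further steps undo the first
  \<open>i\<close>.\<close>

lemma funpow_Per_cancel:
  assumes "\<alpha> \<in> Per \<Gamma> \<phi>" "(\<phi> ^^ (i + d)) \<alpha> = (\<phi> ^^ i) \<alpha>"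
  shows "per \<phi> \<alpha> dvd d"
proof -
  let ?p = "per \<phi> \<alpha>"
  have e: "?p * i - i + i = ?p * i"
    using funpow_per(1)[OF assms(1)] by simp
  have "(\<phi> ^^ d) \<alpha> = (\<phi> ^^ (?p * i - i + (i + d))) \<alpha>"
    using funpow_mult_fixpoint[OF funpow_per(2)[OF assms(1)], of i] e
    by (metis add.assoc add.commute comp_apply funpow_add)
  also have "\<dots> = (\<phi> ^^ (?p * i - i + i)) \<alpha>"
    using assms(2) by (metis comp_apply funpow_add)
  also have "\<dots> = \<alpha>"
    using funpow_mult_fixpoint[OF funpow_per(2)[OF assms(1)], of i] e by simp
  finally show ?thesis
    by (rule funpow_eq_imp_per_dvd[OF assms(1)])
qed

lemma not_quasi_periodic_funpow_inj:
  assumes "\<not> quasi_periodic \<phi> \<alpha>" "(\<phi> ^^ i) \<alpha> = (\<phi> ^^ j) \<alpha>"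
  shows "i = j"
proof (rule ccontr)
  assume "i \<noteq> j"
  \<comment> \<open>Quasi-periodicity asks for exponents from 1 on, so one more application of
    \<phi> covers the exponent 0.\<close>
  moreover have "(\<phi> ^^ Suc i) \<alpha> = (\<phi> ^^ Suc j) \<alpha>"
    using assms(2) by simp
  ultimately show False
    using assms(1) unfolding quasi_periodic_def
    by (metis Suc_less_eq le_add1 linorder_neqE_nat plus_1_eq_Suc)
qed

lemma quasi_periodic_reaches_Per:
  assumes "quasi_periodic \<phi> \<alpha>" "\<And>n. (\<phi> ^^ n) \<alpha> \<in> \<Gamma>"
  obtains k where "(\<phi> ^^ k) \<alpha> \<in> Per \<Gamma> \<phi>"
proof -
  obtain n m where "m > n" "(\<phi> ^^ n) \<alpha> = (\<phi> ^^ m) \<alpha>"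
    using assms(1) by (auto simp: quasi_periodic_def)
  then have "(\<phi> ^^ (m - n)) ((\<phi> ^^ n) \<alpha>) = (\<phi> ^^ n) \<alpha>"
    by (metis comp_apply funpow_add le_add_diff_inverse2 less_imp_le)
  moreover have "m - n \<ge> 1"
    using \<open>m > n\<close> by simp
  ultimately have "(\<phi> ^^ n) \<alpha> \<in> Per \<Gamma> \<phi>"
    using assms(2) unfolding Per_def by blast
  then show thesis
    by (rule that)
qed

section \<open>Anti-orbits of a weighted shift\<close>

text \<open>The carrier and \<Lambda> are separate parameters so that the results serve the original
  shift and also the restricted ones, where the two sets coincide.\<close>

locale weighted_shift =
  fixes \<Gamma> :: "'a set" and \<phi> :: "'a \<Rightarrow> 'a" and w :: "'a \<Rightarrow> 'f :: {field, finite}" and \<Lambda> :: "'a set"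
  assumes maps: "\<phi> \<in> \<Gamma> \<rightarrow> \<Gamma>"
    and core: "\<Lambda> = (\<Inter>n. {\<alpha> \<in> \<Gamma>. (\<phi> ^^ n) \<alpha> \<in> weight_supp \<Gamma> w})"
begin

abbreviation (input) "\<sigma> \<equiv> weighted_gen_shift \<Gamma> \<phi> w"

abbreviation (input) "path_weight \<alpha> k \<equiv> (\<Prod>t<k. w ((\<phi> ^^ t) \<alpha>))"

lemma core_iff: "\<alpha> \<in> \<Lambda> \<longleftrightarrow> \<alpha> \<in> \<Gamma> \<and> w \<alpha> \<noteq> 0 \<and> \<phi> \<alpha> \<in> \<Lambda>"
proof -
  have all_nat: "(\<forall>n. Q n) \<longleftrightarrow> Q 0 \<and> (\<forall>n. Q (Suc n))" for Q :: "nat \<Rightarrow> bool"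
    by (metis nat.exhaust)
  have "(\<forall>n. (\<phi> ^^ n) \<alpha> \<in> weight_supp \<Gamma> w) \<longleftrightarrow>
      \<alpha> \<in> weight_supp \<Gamma> w \<and> (\<forall>n. (\<phi> ^^ n) (\<phi> \<alpha>) \<in> weight_supp \<Gamma> w)"
    by (subst all_nat) (simp add: funpow_swap1)
  then show ?thesis
    using maps by (auto simp: core weight_supp_def)
qed

lemma funpow_core: "\<alpha> \<in> \<Lambda> \<Longrightarrow> (\<phi> ^^ n) \<alpha> \<in> \<Lambda>"
  by (induction n) (simp, metis core_iff comp_apply funpow.simps(2))

lemma funpow_carrier: "\<alpha> \<in> \<Gamma> \<Longrightarrow> (\<phi> ^^ n) \<alpha> \<in> \<Gamma>"
  by (induction n) (use maps in auto)

lemma core_subset: "\<Lambda> \<subseteq> \<Gamma>"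
  by (auto simp: core)

lemma path_weight_nonzero: "\<alpha> \<in> \<Lambda> \<Longrightarrow> path_weight \<alpha> k \<noteq> 0"
  using funpow_core by (auto dest: core_iff[THEN iffD1])

lemma path_weight_add:
  "path_weight \<alpha> (k + l) = path_weight \<alpha> k * path_weight ((\<phi> ^^ k) \<alpha>) l"
  by (induction l) (simp_all add: mult.assoc add.commute[of k] funpow_add)

lemma anti_orbit_iff:
  "anti_orbit (families \<Gamma>) \<sigma> x \<longleftrightarrow>
    (\<forall>n\<ge>1. x n \<in> families \<Gamma> \<and> (\<forall>\<alpha>\<in>\<Gamma>. x n \<alpha> = w \<alpha> * x (Suc n) (\<phi> \<alpha>)))"
proof -
  \<comment> \<open>Outside \<Gamma> both sides are \<open>undefined\<close>, so only the
    coordinates in \<Gamma> count.\<close>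
  have "\<sigma> y = z \<longleftrightarrow> (\<forall>\<alpha>\<in>\<Gamma>. z \<alpha> = w \<alpha> * y (\<phi> \<alpha>))" if "z \<in> families \<Gamma>" for y z
    using PiE_arb[OF that] by (auto simp: weighted_gen_shift_def fun_eq_iff)
  then show ?thesis
    unfolding anti_orbit_def by blast
qed

lemma anti_orbit_iterate:
  assumes "anti_orbit (families \<Gamma>) \<sigma> x" "n \<ge> 1" "\<alpha> \<in> \<Gamma>"
  shows "x n \<alpha> = path_weight \<alpha> k * x (n + k) ((\<phi> ^^ k) \<alpha>)"
proof (induction k)
  case (Suc k)
  have "x (n + k) ((\<phi> ^^ k) \<alpha>) = w ((\<phi> ^^ k) \<alpha>) * x (Suc (n + k)) (\<phi> ((\<phi> ^^ k) \<alpha>))"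
    using assms funpow_carrier by (simp add: anti_orbit_iff)
  then show ?case
    using Suc by simp
qed simp

lemma anti_orbit_outside_core:
  assumes "anti_orbit (families \<Gamma>) \<sigma> x" "n \<ge> 1" "\<alpha> \<in> \<Gamma>" "\<alpha> \<notin> \<Lambda>"
  shows "x n \<alpha> = 0"
proof -
  obtain k where "w ((\<phi> ^^ k) \<alpha>) = 0"
    using assms(3,4) funpow_carrier by (auto simp: core weight_supp_def)
  \<comment> \<open>The product over \<open>t < k\<close> stops just before the zero weight, hence
    \<open>Suc k\<close>.\<close>
  then have "path_weight \<alpha> (Suc k) = 0"
    by simp
  then show ?thesis
    using anti_orbit_iterate[OF assms(1-3), of "Suc k"] by simp
qed

text \<open>Each turn of length \<open>p\<close> multiplies by the same path weight, a unit, whose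
  power to the number of units is 1. The free factor \<open>l\<close> allows passing to a common
  multiple of several periods.\<close>

lemma anti_orbit_Per:
  assumes "anti_orbit (families \<Gamma>) \<sigma> x" "n \<ge> 1" "\<alpha> \<in> \<Lambda>" "(\<phi> ^^ p) \<alpha> = \<alpha>"
  shows "x (n + p * (card (UNIV - {0 :: 'f}) * l)) \<alpha> = x n \<alpha>"
proof -
  have \<alpha>: "\<alpha> \<in> \<Gamma>"
    using assms(3) core_subset by auto
  have "x n \<alpha> = path_weight \<alpha> p ^ k * x (n + p * k) \<alpha>" for k
  proof (induction k)
    case (Suc k)
    have "x (n + p * k) \<alpha> = path_weight \<alpha> p * x (n + p * k + p) \<alpha>"
      using anti_orbit_iterate[OF assms(1) _ \<alpha>, of "n + p * k" p] assms(2,4) by simp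
    then show ?case
      using Suc by (simp add: algebra_simps)
  qed simp
  from this[of "card (UNIV - {0 :: 'f}) * l"] show ?thesis
    unfolding power_mult finite_field_power_eq_1[OF path_weight_nonzero[OF assms(3)]] by simp
qed

section \<open>Entropy zero when the periods are bounded\<close>

lemma ent_cset_eq_0:
  assumes qp: "\<forall>\<alpha>\<in>\<Lambda>. quasi_periodic \<phi> \<alpha>"
    and bound: "\<forall>\<alpha>\<in>Per \<Gamma> \<phi> \<inter> \<Lambda>. per \<phi> \<alpha> \<le> N"
  shows "ent_cset (families \<Gamma>) \<sigma> = 0"
  unfolding ent_cset_def
proof (rule anti_orbit_number_zero)
  fix x
  assume x: "anti_orbit (families \<Gamma>) \<sigma> x"
  \<comment> \<open>\<open>fact N\<close> is a multiple of every period that occurs; the second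
    factor makes the weight of a full turn disappear.\<close>
  define M where "M = fact N * card (UNIV - {0 :: 'f})"
  have "(1 :: 'f) \<in> UNIV - {0}"
    by simp
  then have "M > 0"
    unfolding M_def by (metis card_gt_0_iff empty_iff fact_gt_zero finite nat_0_less_mult_iff)
  have periodic: "x (n + M) \<beta> = x n \<beta>" if "n \<ge> 1" "\<beta> \<in> Per \<Gamma> \<phi> \<inter> \<Lambda>" for n \<beta>
  proof -
    have "per \<phi> \<beta> dvd fact N"
      using bound funpow_per(1)[of \<beta> \<Gamma> \<phi>] that(2) by (intro dvd_fact) auto
    then obtain l where "fact N = per \<phi> \<beta> * l" ..
    then show ?thesis
      using anti_orbit_Per[OF x that(1) _ funpow_per(2), of \<beta> \<Gamma> l] that(2)
      by (simp add: M_def ac_simps)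
  qed
  \<comment> \<open>For \<alpha> in \<Lambda>, \<open>k\<close> steps lead to a periodic point, and
    both terms are the same path weight times values there that agree by \<open>periodic\<close>.
    Elsewhere both are 0, or \<open>undefined\<close> outside \<Gamma>.\<close>
  have "x (1 + M) \<alpha> = x 1 \<alpha>" for \<alpha>
  proof (cases "\<alpha> \<in> \<Lambda>")
    case True
    then obtain k where "(\<phi> ^^ k) \<alpha> \<in> Per \<Gamma> \<phi>"
      using quasi_periodic_reaches_Per[of \<phi> \<alpha> \<Gamma>] qp funpow_core core_subset by blast
    then have "x (1 + k + M) ((\<phi> ^^ k) \<alpha>) = x (1 + k) ((\<phi> ^^ k) \<alpha>)"
      using funpow_core[OF True] by (intro periodic) simp_all
    then show ?thesis
      using anti_orbit_iterate[OF x _ , of 1 \<alpha> k] anti_orbit_iterate[OF x _ , of "1 + M" \<alpha> k]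
        True core_subset by (auto simp: ac_simps)
  next
    case False
    show ?thesis
    proof (cases "\<alpha> \<in> \<Gamma>")
      case True
      then show ?thesis
        using anti_orbit_outside_core[OF x] False by simp
    next
      case False
      have "x 1 \<in> families \<Gamma>" "x (1 + M) \<in> families \<Gamma>"
        using x by (auto simp: anti_orbit_iff)
      then show ?thesis
        using False by (metis PiE_arb)
    qed
  qed
  then have "x (1 + M) = x 1"
    by blast
  then show "\<not> inj_on x {1..}"
    using \<open>M > 0\<close> by (auto dest!: inj_onD)
qed

section \<open>Anti-orbits with prescribed support\<close>

text \<open>The space-time map \<open>(n, \<alpha>) \<mapsto> (n + 1, \<phi> \<alpha>)\<close> has no periodic points, so
  the weights become a coboundary there: fix a base point in each of its grand orbits and compare
  path weights up to a time at which the two trajectories have merged.\<close>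

lemma gauge_exists:
  obtains g :: "nat \<Rightarrow> 'a \<Rightarrow> 'f"
  where "\<And>n \<alpha>. \<alpha> \<in> \<Lambda> \<Longrightarrow> g n \<alpha> \<noteq> 0"
    and "\<And>n \<alpha>. \<alpha> \<in> \<Lambda> \<Longrightarrow> g n \<alpha> = w \<alpha> * g (Suc n) (\<phi> \<alpha>)"
proof -
  \<comment> \<open>\<open>pos N y\<close> is the place at time \<open>N\<close> of the trajectory
    started at the space-time point \<open>y\<close>, and \<open>G N y\<close> is the weight
    collected until then. Both are meaningful from time \<open>fst y\<close> on, which
    \<open>meet\<close> demands.\<close>
  define pos where "pos N y = (\<phi> ^^ (N - fst y)) (snd y)" for N and y :: "nat \<times> 'a"
  define G where "G N y = path_weight (snd y) (N - fst y)" for N and y :: "nat \<times> 'a"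
  define meet where "meet N y z \<longleftrightarrow> fst y \<le> N \<and> fst z \<le> N \<and> pos N y = pos N z" for N y z
  define base where "base y = (SOME z. snd z \<in> \<Lambda> \<and> (\<exists>N. meet N y z))" for y
  define g where "g y = G (SOME N. meet N y (base y)) y / G (SOME N. meet N y (base y)) (base y)" for y
  have pos_add: "pos (N + d) y = (\<phi> ^^ d) (pos N y)" if "fst y \<le> N" for N d y
  proof -
    have "N + d - fst y = d + (N - fst y)"
      using that by simp
    then show ?thesis
      by (simp add: pos_def funpow_add)
  qed
  have G_add: "G (N + d) y = G N y * path_weight (pos N y) d" if "fst y \<le> N" for N d y
    using that path_weight_add[of "snd y" "N - fst y" d] by (simp add: G_def pos_def)
  have G_nz: "G N y \<noteq> 0" if "snd y \<in> \<Lambda>" for N y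
    unfolding G_def by (rule path_weight_nonzero[OF that])
  have pos_core: "pos N y \<in> \<Lambda>" if "snd y \<in> \<Lambda>" for N y
    unfolding pos_def by (rule funpow_core[OF that])
  have meet_mono: "meet (N + d) y z" if "meet N y z" for N d y z
    using that by (simp add: meet_def pos_add)
  \<comment> \<open>After merging, both trajectories collect the same nonzero weights, so the
    quotient no longer changes; the two times are compared at \<open>N + M\<close>.\<close>
  have ratio: "G N y / G N z = G M y / G M z"
    if "meet N y z" "meet M y z" "snd y \<in> \<Lambda>" for N M y z
  proof -
    have *: "G (N + d) y / G (N + d) z = G N y / G N z" if "meet N y z" for N d
      using that \<open>snd y \<in> \<Lambda>\<close> path_weight_nonzero[OF pos_core, of y N d]
      by (simp add: meet_def G_add)
    show ?thesis
      using *[OF that(1), of M] *[OF that(2), of N] by (simp add: add.commute)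
  qed
  have base: "snd (base y) \<in> \<Lambda>" "\<exists>N. meet N y (base y)" if "snd y \<in> \<Lambda>" for y
  proof -
    have "snd y \<in> \<Lambda> \<and> (\<exists>N. meet N y y)"
      using that by (auto simp: meet_def)
    then have "\<exists>z. snd z \<in> \<Lambda> \<and> (\<exists>N. meet N y z)" ..
    from someI_ex[OF this] show "snd (base y) \<in> \<Lambda>" "\<exists>N. meet N y (base y)"
      by (auto simp: base_def)
  qed
  have g_eq: "g y = G N y / G N (base y)" if "snd y \<in> \<Lambda>" "meet N y (base y)" for N y
    unfolding g_def by (rule ratio[OF someI_ex[OF base(2)[OF that(1)]] that(2,1)])
  define step where "step y = (Suc (fst y), \<phi> (snd y))" for y :: "nat \<times> 'a"
  have pos_step: "pos N (step y) = pos N y" if "Suc (fst y) \<le> N" for N y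
  proof -
    have "N - fst y = Suc (N - Suc (fst y))"
      using that by simp
    then show ?thesis
      by (simp add: pos_def step_def funpow_swap1)
  qed
  have meet_step: "(\<exists>N. meet N (step y) z) \<longleftrightarrow> (\<exists>N. meet N y z)" for y z
  proof
    assume "\<exists>N. meet N (step y) z"
    then obtain N where "meet N (step y) z" ..
    then have "meet N y z"
      using pos_step[of y N] by (auto simp: meet_def) (auto simp: step_def)
    then show "\<exists>N. meet N y z" ..
  next
    assume "\<exists>N. meet N y z"
    then obtain N where "meet N y z" ..
    \<comment> \<open>One extra unit of time makes room for the step in case
      \<open>fst y = N\<close>.\<close>
    from meet_mono[OF this, of 1] have "meet (N + 1) (step y) z"
      using pos_step[of y "N + 1"] \<open>meet N y z\<close> by (auto simp: meet_def) (auto simp: step_def)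
    then show "\<exists>N. meet N (step y) z" ..
  qed
  \<comment> \<open>The choice operator is applied to equivalent predicates and so returns the same
    point.\<close>
  have base_step: "base (step y) = base y" for y
    by (simp add: base_def meet_step)
  show thesis
  proof
    fix n :: nat and \<alpha> :: 'a
    assume \<alpha>: "\<alpha> \<in> \<Lambda>"
    let ?y = "(n, \<alpha>)"
    obtain M where "meet M ?y (base ?y)"
      using base(2)[of ?y] \<alpha> by auto
    then show "curry g n \<alpha> \<noteq> 0"
      using G_nz[of ?y M] G_nz[OF base(1)[of ?y], of M] \<alpha> g_eq[of ?y M] by simp
    have step: "step ?y = (Suc n, \<phi> \<alpha>)" and \<phi>\<alpha>: "\<phi> \<alpha> \<in> \<Lambda>"
      using core_iff[of \<alpha>] \<alpha> by (auto simp: step_def)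
    obtain N where N: "meet N (step ?y) (base ?y)"
      using base(2)[of "step ?y"] \<phi>\<alpha> unfolding base_step by (auto simp: step)
    then have "meet N ?y (base ?y)"
      using pos_step[of ?y N] by (auto simp: meet_def step)
    then have "g ?y = G N ?y / G N (base ?y)"
      using \<alpha> by (simp add: g_eq)
    moreover have "g (step ?y) = G N (step ?y) / G N (base ?y)"
      using g_eq[of "step ?y" N] N \<phi>\<alpha> unfolding base_step by (simp add: step)
    moreover have "N - n = 1 + (N - Suc n)"
      using N by (auto simp: meet_def step)
    then have "G N ?y = w \<alpha> * G N (step ?y)"
      using path_weight_add[of \<alpha> 1 "N - Suc n"] by (simp add: G_def step)
    ultimately show "curry g n \<alpha> = w \<alpha> * curry g (Suc n) (\<phi> \<alpha>)"
      by (simp add: step)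
  qed
qed

text \<open>The condition says that the space-time trajectory of (n, \<alpha>) merges with that of
  (0, \<beta>) for a seed \<beta> in \<open>K\<close>: at time \<open>N + n\<close> they stand at
  the two sides of the equation. It is invariant under the space-time map, so the gauge may be cut
  off to the points satisfying it.\<close>

lemma seeded_anti_orbit:
  obtains x :: "nat \<Rightarrow> 'a \<Rightarrow> 'f"
  where "anti_orbit (families \<Gamma>) \<sigma> x"
    and "\<And>n \<alpha>. \<alpha> \<in> \<Lambda> \<Longrightarrow> x n \<alpha> \<noteq> 0 \<longleftrightarrow> (\<exists>\<beta>\<in>K. \<exists>N. (\<phi> ^^ N) \<alpha> = (\<phi> ^^ (N + n)) \<beta>)"
proof -
  define P where "P n \<alpha> \<longleftrightarrow> (\<exists>\<beta>\<in>K. \<exists>N. (\<phi> ^^ N) \<alpha> = (\<phi> ^^ (N + n)) \<beta>)" for n \<alpha>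
  have P_step: "P (Suc n) (\<phi> \<alpha>) \<longleftrightarrow> P n \<alpha>" for n \<alpha>
  proof
    assume "P (Suc n) (\<phi> \<alpha>)"
    then obtain \<beta> N where "\<beta> \<in> K" "(\<phi> ^^ Suc N) \<alpha> = (\<phi> ^^ (Suc N + n)) \<beta>"
      by (auto simp: P_def funpow_swap1)
    then show "P n \<alpha>"
      unfolding P_def by blast
  next
    assume "P n \<alpha>"
    then obtain \<beta> N where "\<beta> \<in> K" "(\<phi> ^^ N) \<alpha> = (\<phi> ^^ (N + n)) \<beta>"
      by (auto simp: P_def)
    then have "(\<phi> ^^ N) (\<phi> \<alpha>) = (\<phi> ^^ (N + Suc n)) \<beta>"
      by (simp flip: funpow_swap1)
    then show "P (Suc n) (\<phi> \<alpha>)"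
      using \<open>\<beta> \<in> K\<close> unfolding P_def by blast
  qed
  obtain g :: "nat \<Rightarrow> 'a \<Rightarrow> 'f" where g: "\<And>n \<alpha>. \<alpha> \<in> \<Lambda> \<Longrightarrow> g n \<alpha> \<noteq> (0 :: 'f)"
    "\<And>n \<alpha>. \<alpha> \<in> \<Lambda> \<Longrightarrow> g n \<alpha> = w \<alpha> * g (Suc n) (\<phi> \<alpha>)"
    using gauge_exists by blast
  \<comment> \<open>Extension by 0 respects the shift equation: if \<alpha> is outside \<Lambda>,
    then \<open>w \<alpha> = 0\<close> or \<open>\<phi> \<alpha>\<close> is outside
    \<Lambda>.\<close>
  define x where "x n = (\<lambda>\<alpha>\<in>\<Gamma>. if \<alpha> \<in> \<Lambda> \<and> P n \<alpha> then g n \<alpha> else 0)" for n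
  show thesis
  proof
    show "anti_orbit (families \<Gamma>) \<sigma> x"
      unfolding anti_orbit_iff
    proof (intro allI impI conjI ballI)
      fix n \<alpha>
      assume "\<alpha> \<in> \<Gamma>"
      moreover from this have "\<phi> \<alpha> \<in> \<Gamma>"
        using maps by auto
      ultimately show "x n \<alpha> = w \<alpha> * x (Suc n) (\<phi> \<alpha>)"
        using g(2)[of \<alpha> n] core_iff[of \<alpha>] by (auto simp: x_def P_step)
    qed (auto simp: x_def)
    show "x n \<alpha> \<noteq> 0 \<longleftrightarrow> (\<exists>\<beta>\<in>K. \<exists>N. (\<phi> ^^ N) \<alpha> = (\<phi> ^^ (N + n)) \<beta>)" if "\<alpha> \<in> \<Lambda>" for n \<alpha>
      using that core_subset g(1) by (auto simp: x_def P_def)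
  qed
qed

section \<open>Infinite entropy from seed sets\<close>

text \<open>Equal terms have equal supports, so it suffices to find seed sets for which the support
  on \<Lambda> determines the pair \<open>(i, n)\<close>.\<close>

lemma ent_cset_eq_infinity:
  fixes K :: "nat \<Rightarrow> 'a set"
  assumes "\<And>i j n m. \<lbrakk>n \<ge> 1; m \<ge> 1;
      \<And>\<alpha>. \<alpha> \<in> \<Lambda> \<Longrightarrow> (\<exists>\<beta>\<in>K i. \<exists>N. (\<phi> ^^ N) \<alpha> = (\<phi> ^^ (N + n)) \<beta>) \<longleftrightarrow>
        (\<exists>\<beta>\<in>K j. \<exists>N. (\<phi> ^^ N) \<alpha> = (\<phi> ^^ (N + m)) \<beta>)\<rbrakk> \<Longrightarrow> i = j \<and> n = (m :: nat)"
  shows "ent_cset (families \<Gamma>) \<sigma> = \<infinity>"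
proof -
  have "\<forall>i. \<exists>x :: nat \<Rightarrow> 'a \<Rightarrow> 'f. anti_orbit (families \<Gamma>) \<sigma> x \<and> (\<forall>n. \<forall>\<alpha>\<in>\<Lambda>.
      x n \<alpha> \<noteq> 0 \<longleftrightarrow> (\<exists>\<beta>\<in>K i. \<exists>N. (\<phi> ^^ N) \<alpha> = (\<phi> ^^ (N + n)) \<beta>))"
    by (metis seeded_anti_orbit)
  then obtain s :: "nat \<Rightarrow> nat \<Rightarrow> 'a \<Rightarrow> 'f"
    where orb: "\<And>i. anti_orbit (families \<Gamma>) \<sigma> (s i)"
      and supp: "\<And>i n \<alpha>. \<alpha> \<in> \<Lambda> \<Longrightarrow>
        s i n \<alpha> \<noteq> 0 \<longleftrightarrow> (\<exists>\<beta>\<in>K i. \<exists>N. (\<phi> ^^ N) \<alpha> = (\<phi> ^^ (N + n)) \<beta>)"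
    by metis
  have "i = j \<and> n = m" if "n \<ge> 1" "m \<ge> 1" "s i n = s j m" for i j n m
    using that by (intro assms) (simp_all flip: supp)
  then show ?thesis
    unfolding ent_cset_def using orb anti_orbit_number_infinity by blast
qed

text \<open>With seeds \<alpha> and its iterate number \<open>i + 1\<close>, term \<open>n\<close>
  meets the trajectory of \<alpha> exactly at the exponents \<open>n\<close> and
  \<open>n + i + 1\<close>. The smaller one gives \<open>n\<close>, the gap gives
  \<open>i\<close>.\<close>

lemma ent_cset_not_quasi_periodic:
  assumes \<alpha>: "\<alpha> \<in> \<Lambda>" "\<not> quasi_periodic \<phi> \<alpha>"
  shows "ent_cset (families \<Gamma>) \<sigma> = \<infinity>"
proof (rule ent_cset_eq_infinity)
  let ?K = "\<lambda>i. {\<alpha>, (\<phi> ^^ Suc i) \<alpha>}"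
  fix i j n m :: nat
  have *: "(\<exists>\<beta>\<in>?K i. \<exists>N. (\<phi> ^^ N) ((\<phi> ^^ l) \<alpha>) = (\<phi> ^^ (N + n)) \<beta>) \<longleftrightarrow> l = n \<or> l = n + Suc i"
    for i n l
  proof -
    have "(\<phi> ^^ N) ((\<phi> ^^ l) \<alpha>) = (\<phi> ^^ (N + n)) ((\<phi> ^^ k) \<alpha>) \<longleftrightarrow> l = n + k" for N k
      using not_quasi_periodic_funpow_inj[OF \<alpha>(2), of "N + l" "N + n + k"]
      by (auto simp: funpow_add)
    from this[of _ 0] this[of _ "Suc i"] show ?thesis
      by auto
  qed
  assume "\<And>\<gamma>. \<gamma> \<in> \<Lambda> \<Longrightarrow> (\<exists>\<beta>\<in>?K i. \<exists>N. (\<phi> ^^ N) \<gamma> = (\<phi> ^^ (N + n)) \<beta>) \<longleftrightarrow>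
    (\<exists>\<beta>\<in>?K j. \<exists>N. (\<phi> ^^ N) \<gamma> = (\<phi> ^^ (N + m)) \<beta>)"
  from this[OF funpow_core[OF \<alpha>(1)]] have "l = n \<or> l = n + Suc i \<longleftrightarrow> l = m \<or> l = m + Suc j" for l
    unfolding * .
  from this[of n] this[of m] this[of "n + Suc i"] this[of "m + Suc j"] show "i = j \<and> n = m"
    by presburger
qed

text \<open>The seeds \<open>b k\<close> lie on cycles of strictly increasing length
  \<open>e k\<close>, and family \<open>i\<close> uses all those with k \<ge> i. The set of cycles
  met gives \<open>i\<close>. One cycle determines \<open>n\<close> only modulo its length, so each
  family needs arbitrarily long cycles.\<close>

lemma ent_cset_unbounded_periods:
  assumes "(SUP \<alpha>\<in>Per \<Gamma> \<phi> \<inter> \<Lambda>. enat (per \<phi> \<alpha>)) = \<infinity>"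
  shows "ent_cset (families \<Gamma>) \<sigma> = \<infinity>"
proof -
  define Q where "Q = per \<phi> ` (Per \<Gamma> \<phi> \<inter> \<Lambda>)"
  have "infinite Q"
  proof
    assume "finite Q"
    then obtain N where "\<forall>p\<in>Q. p \<le> N"
      by (auto simp: finite_nat_set_iff_bounded_le)
    then have "(SUP \<alpha>\<in>Per \<Gamma> \<phi> \<inter> \<Lambda>. enat (per \<phi> \<alpha>)) \<le> enat N"
      by (intro SUP_least) (auto simp: Q_def)
    with assms show False
      by simp
  qed
  then obtain e :: "nat \<Rightarrow> nat" where e: "strict_mono e" "\<And>k. e k \<in> Q"
    using infinite_enumerate by blast
  then have "\<forall>k. \<exists>\<beta>. \<beta> \<in> Per \<Gamma> \<phi> \<inter> \<Lambda> \<and> per \<phi> \<beta> = e k"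
    unfolding Q_def by (metis imageE)
  then obtain b where b: "\<And>k. b k \<in> Per \<Gamma> \<phi>" "\<And>k. b k \<in> \<Lambda>" "\<And>k. per \<phi> (b k) = e k"
    by (metis IntE)
  have same: "k = l" if "(\<phi> ^^ i) (b k) = (\<phi> ^^ j) (b l)" for k l i j
  proof -
    have "e k dvd e l" "e l dvd e k"
      using per_dvd_of_meet[OF b(1) b(1) that] per_dvd_of_meet[OF b(1) b(1) that[symmetric]]
      by (simp_all add: b(3))
    then have "e k = e l"
      by (rule dvd_antisym)
    then show ?thesis
      using e(1) by (simp add: strict_mono_eq)
  qed
  let ?K = "\<lambda>i. b ` {i..}"
  show ?thesis
  proof (rule ent_cset_eq_infinity)
    fix i j n m :: nat
    assume eq: "\<And>\<gamma>. \<gamma> \<in> \<Lambda> \<Longrightarrow> (\<exists>\<beta>\<in>?K i. \<exists>N. (\<phi> ^^ N) \<gamma> = (\<phi> ^^ (N + n)) \<beta>) \<longleftrightarrow>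
      (\<exists>\<beta>\<in>?K j. \<exists>N. (\<phi> ^^ N) \<gamma> = (\<phi> ^^ (N + m)) \<beta>)"
    have seed: "(\<exists>\<beta>\<in>?K i. \<exists>N. (\<phi> ^^ N) ((\<phi> ^^ l) (b k)) = (\<phi> ^^ (N + n)) \<beta>) \<longleftrightarrow>
        i \<le> k \<and> (\<exists>N. (\<phi> ^^ (N + l)) (b k) = (\<phi> ^^ (N + n)) (b k))" for i l k n
    proof
      assume "\<exists>\<beta>\<in>?K i. \<exists>N. (\<phi> ^^ N) ((\<phi> ^^ l) (b k)) = (\<phi> ^^ (N + n)) \<beta>"
      then obtain k' N where "i \<le> k'" "(\<phi> ^^ (N + l)) (b k) = (\<phi> ^^ (N + n)) (b k')"
        by (auto simp: funpow_add)
      then show "i \<le> k \<and> (\<exists>N. (\<phi> ^^ (N + l)) (b k) = (\<phi> ^^ (N + n)) (b k))"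
        using same by blast
    qed (auto simp: funpow_add)
    have eq': "i \<le> k \<and> (\<exists>N. (\<phi> ^^ (N + l)) (b k) = (\<phi> ^^ (N + n)) (b k)) \<longleftrightarrow>
        j \<le> k \<and> (\<exists>N. (\<phi> ^^ (N + l)) (b k) = (\<phi> ^^ (N + m)) (b k))" for k l
      using eq[OF funpow_core[OF b(2)]] unfolding seed .
    \<comment> \<open>With \<open>l\<close> equal to \<open>n\<close> or to \<open>m\<close>, one of
      the two existential statements is trivially true.\<close>
    have "i \<le> k \<longleftrightarrow> j \<le> k" for k
      using eq'[of k n] eq'[of k m] by auto
    then have ij: "i = j"
      by (meson le_antisym order_refl)
    \<comment> \<open>This \<open>k\<close> is at least \<open>i\<close>, so its cycle is seeded,
      and e k \<ge> k exceeds both \<open>n\<close> and \<open>m\<close>.\<close>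
    define k where "k = i + n + m + 1"
    have "n < e k" "m < e k"
      using strict_mono_imp_increasing[OF e(1), of k] by (auto simp: k_def)
    obtain N where N: "(\<phi> ^^ (N + n)) (b k) = (\<phi> ^^ (N + m)) (b k)"
      using eq'[of k n] by (auto simp: k_def)
    \<comment> \<open>Subtraction is truncated: each difference is either 0 by default or treated by
      cancellation. Both are below \<open>e k\<close>, so divisibility makes them 0.\<close>
    have "e k dvd n - m"
      using funpow_Per_cancel[OF b(1), of "N + m" "n - m" k] N by (cases "m \<le> n") (auto simp: b(3))
    moreover have "e k dvd m - n"
      using funpow_Per_cancel[OF b(1), of "N + n" "m - n" k] N by (cases "n \<le> m") (auto simp: b(3))
    ultimately have "n - m = 0" "m - n = 0"
      using \<open>n < e k\<close> \<open>m < e k\<close> by (meson dvd_imp_le diff_le_self le_less_trans not_less not_gr_zero)+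
    then show "i = j \<and> n = m"
      using ij by simp
  qed
qed

section \<open>The value of the entropy\<close>

lemma ent_cset_cases:
  "ent_cset (families \<Gamma>) \<sigma> =
    (if \<exists>\<alpha>\<in>\<Lambda>. \<not> quasi_periodic \<phi> \<alpha> then \<infinity>
     else if Per \<Gamma> \<phi> \<inter> \<Lambda> \<noteq> {} \<and> (SUP \<alpha>\<in>Per \<Gamma> \<phi> \<inter> \<Lambda>. enat (per \<phi> \<alpha>)) = \<infinity> then \<infinity>
     else 0)"
proof -
  have "ent_cset (families \<Gamma>) \<sigma> = 0"
    if qp: "\<forall>\<alpha>\<in>\<Lambda>. quasi_periodic \<phi> \<alpha>"
      and bdd: "Per \<Gamma> \<phi> \<inter> \<Lambda> = {} \<or> (SUP \<alpha>\<in>Per \<Gamma> \<phi> \<inter> \<Lambda>. enat (per \<phi> \<alpha>)) \<noteq> \<infinity>"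
  proof -
    \<comment> \<open>If there are no periodic points in \<Lambda>, the supremum is the bottom
      element 0, so a finite bound exists in either case.\<close>
    obtain N where N: "(SUP \<alpha>\<in>Per \<Gamma> \<phi> \<inter> \<Lambda>. enat (per \<phi> \<alpha>)) = enat N"
      using bdd by (auto simp: bot_enat_def zero_enat_def)
    have "per \<phi> \<alpha> \<le> N" if "\<alpha> \<in> Per \<Gamma> \<phi> \<inter> \<Lambda>" for \<alpha>
      using SUP_upper[OF that, of "\<lambda>\<alpha>. enat (per \<phi> \<alpha>)"] unfolding N by simp
    then show ?thesis
      using ent_cset_eq_0[OF qp] by blast
  qed
  then show ?thesis
    using ent_cset_not_quasi_periodic ent_cset_unbounded_periods by auto
qed

end

section \<open>Finite fibres and restriction to \<Lambda>\<close>

text \<open>A coordinate outside the image of the support is never read with nonzero weight, so its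
  indicator family lies in the fibre over 0; distinct coordinates give distinct families.\<close>

lemma finite_fibre_weighted_imp_finite:
  assumes "\<phi> \<in> \<Gamma> \<rightarrow> \<Gamma>"
    and "finite_fibre (families \<Gamma>) (weighted_gen_shift \<Gamma> \<phi> (w :: 'a \<Rightarrow> 'f :: field))"
  shows "finite (\<Gamma> - \<phi> ` weight_supp \<Gamma> w)"
proof -
  define \<delta> where "\<delta> d = (\<lambda>\<alpha>\<in>\<Gamma>. if \<alpha> = d then 1 else 0 :: 'f)" for d
  let ?D = "\<Gamma> - \<phi> ` weight_supp \<Gamma> w" and ?z = "\<lambda>\<alpha>\<in>\<Gamma>. 0 :: 'f"
  have "finite {x \<in> families \<Gamma>. weighted_gen_shift \<Gamma> \<phi> w x = ?z}"
    using assms by (simp add: finite_fibre_def)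
  moreover have "\<delta> ` ?D \<subseteq> {x \<in> families \<Gamma>. weighted_gen_shift \<Gamma> \<phi> w x = ?z}"
    using assms(1) by (auto simp: \<delta>_def weighted_gen_shift_def weight_supp_def intro!: restrict_ext)
  ultimately have "finite (\<delta> ` ?D)"
    by (rule finite_subset[rotated])
  moreover have "inj_on \<delta> ?D"
    by (auto simp: inj_on_def \<delta>_def fun_eq_iff restrict_def split: if_splits)
  ultimately show ?thesis
    by (rule finite_imageD)
qed

lemma finite_fibre_weighted:
  fixes w :: "'a \<Rightarrow> 'f :: {field, finite}"
  assumes "finite (\<Gamma> - \<phi> ` \<Gamma>)" "\<And>\<alpha>. \<alpha> \<in> \<Gamma> \<Longrightarrow> w \<alpha> \<noteq> 0"
  shows "finite_fibre (families \<Gamma>) (weighted_gen_shift \<Gamma> \<phi> w)"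
  unfolding finite_fibre_def
proof (intro conjI ballI)
  let ?D = "\<Gamma> - \<phi> ` \<Gamma>"
  fix y
  let ?X = "{x \<in> families \<Gamma>. weighted_gen_shift \<Gamma> \<phi> w x = y}"
  have "inj_on (\<lambda>x. restrict x ?D) ?X"
  proof (rule inj_onI, rule ext)
    fix x x' \<alpha>
    assume x: "x \<in> ?X" and x': "x' \<in> ?X" and eq: "restrict x ?D = restrict x' ?D"
    consider "\<alpha> \<in> ?D" | \<beta> where "\<beta> \<in> \<Gamma>" "\<alpha> = \<phi> \<beta>" | "\<alpha> \<notin> \<Gamma>"
      by blast
    then show "x \<alpha> = x' \<alpha>"
    proof cases
      case 1
      then show ?thesis
        using fun_cong[OF eq, of \<alpha>] by simp
    next
      case 2
      have "weighted_gen_shift \<Gamma> \<phi> w x \<beta> = weighted_gen_shift \<Gamma> \<phi> w x' \<beta>"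
        using x x' by simp
      then show ?thesis
        using 2 assms(2) by (simp add: weighted_gen_shift_def)
    next
      case 3
      have "x \<in> families \<Gamma>" "x' \<in> families \<Gamma>"
        using x x' by auto
      then show ?thesis
        using 3 by (metis PiE_arb)
    qed
  qed
  moreover have "finite ((\<lambda>x. restrict x ?D) ` ?X)"
    by (rule finite_subset[OF _ finite_PiE[OF assms(1), of "\<lambda>_. UNIV"]]) auto
  ultimately show "finite ?X"
    by (rule finite_imageD[rotated])
qed (auto simp: weighted_gen_shift_def)

lemma gen_shift_eq_weighted: "gen_shift \<Gamma> \<phi> = weighted_gen_shift \<Gamma> \<phi> (\<lambda>_. 1 :: 'f :: field)"
  by (simp add: fun_eq_iff gen_shift_def weighted_gen_shift_def)

lemma funpow_restrict:
  assumes "\<phi> ` \<Lambda> \<subseteq> \<Lambda>" "\<alpha> \<in> \<Lambda>"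
  shows "(restrict \<phi> \<Lambda> ^^ n) \<alpha> = (\<phi> ^^ n) \<alpha> \<and> (\<phi> ^^ n) \<alpha> \<in> \<Lambda>"
  by (induction n) (use assms in auto)

lemma weighted_shift_restrict:
  assumes "\<phi> ` \<Lambda> \<subseteq> \<Lambda>" "\<And>\<alpha>. \<alpha> \<in> \<Lambda> \<Longrightarrow> w \<alpha> \<noteq> 0"
  shows "weighted_shift \<Lambda> (restrict \<phi> \<Lambda>) w \<Lambda>"
proof
  show "restrict \<phi> \<Lambda> \<in> \<Lambda> \<rightarrow> \<Lambda>"
    using assms(1) by auto
  show "\<Lambda> = (\<Inter>n. {\<alpha> \<in> \<Lambda>. (restrict \<phi> \<Lambda> ^^ n) \<alpha> \<in> weight_supp \<Lambda> w})"
    using funpow_restrict[OF assms(1)] assms(2) by (auto simp: weight_supp_def)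
qed

theorem theorem4p18:
  fixes \<Gamma> :: "'a set" and \<phi> :: "'a \<Rightarrow> 'a" and w :: "'a \<Rightarrow> 'f :: {field, finite}" and \<Lambda> :: "'a set"
  assumes "\<Gamma> \<noteq> {}" and "\<phi> \<in> \<Gamma> \<rightarrow> \<Gamma>"
    and "finite_fibre (families \<Gamma>) (weighted_gen_shift \<Gamma> \<phi> w)"
    and "\<Lambda> = (\<Inter>n. {\<alpha> \<in> \<Gamma>. (\<phi> ^^ n) \<alpha> \<in> weight_supp \<Gamma> w})"
  shows "\<phi> ` \<Lambda> \<subseteq> \<Lambda> \<and>
    finite_fibre (families \<Lambda>) (weighted_gen_shift \<Lambda> (restrict \<phi> \<Lambda>) (restrict w \<Lambda>)) \<and>
    finite_fibre (families \<Lambda> :: ('a \<Rightarrow> 'f) set) (gen_shift \<Lambda> (restrict \<phi> \<Lambda>)) \<and>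
    ent_cset (families \<Gamma>) (weighted_gen_shift \<Gamma> \<phi> w) =
      ent_cset (families \<Lambda>) (weighted_gen_shift \<Lambda> (restrict \<phi> \<Lambda>) (restrict w \<Lambda>)) \<and>
    ent_cset (families \<Lambda>) (weighted_gen_shift \<Lambda> (restrict \<phi> \<Lambda>) (restrict w \<Lambda>)) =
      ent_cset (families \<Lambda> :: ('a \<Rightarrow> 'f) set) (gen_shift \<Lambda> (restrict \<phi> \<Lambda>)) \<and>
    ent_cset (families \<Gamma>) (weighted_gen_shift \<Gamma> \<phi> w) =
      (if \<exists>\<alpha>\<in>\<Lambda>. \<not> quasi_periodic \<phi> \<alpha> then \<infinity>
       else if Per \<Gamma> \<phi> \<inter> \<Lambda> \<noteq> {} \<and> (SUP \<alpha>\<in>Per \<Gamma> \<phi> \<inter> \<Lambda>. enat (per \<phi> \<alpha>)) = \<infinity> then \<infinity>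
       else 0)"
proof -
  interpret weighted_shift \<Gamma> \<phi> w \<Lambda>
    using assms(2,4) by unfold_locales
  let ?\<psi> = "restrict \<phi> \<Lambda>"
  have inv: "\<phi> ` \<Lambda> \<subseteq> \<Lambda>" and nz: "\<And>\<alpha>. \<alpha> \<in> \<Lambda> \<Longrightarrow> w \<alpha> \<noteq> 0"
    by (auto dest: core_iff[THEN iffD1])
  \<comment> \<open>If \<alpha> in \<Lambda> equals \<open>\<phi> \<beta>\<close> with \<beta> in
    the support, then \<beta> is itself in \<Lambda>. This bounds the set by one that finite fibres
    force to be finite.\<close>
  have "\<Lambda> - ?\<psi> ` \<Lambda> \<subseteq> \<Gamma> - \<phi> ` weight_supp \<Gamma> w"
  proof
    fix \<alpha>
    assume \<alpha>: "\<alpha> \<in> \<Lambda> - ?\<psi> ` \<Lambda>"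
    have "\<alpha> \<noteq> \<phi> \<beta>" if "\<beta> \<in> weight_supp \<Gamma> w" for \<beta>
      using \<alpha> that core_iff[of \<beta>] by (auto simp: weight_supp_def)
    then show "\<alpha> \<in> \<Gamma> - \<phi> ` weight_supp \<Gamma> w"
      using \<alpha> core_subset by auto
  qed
  then have fin: "finite (\<Lambda> - ?\<psi> ` \<Lambda>)"
    using finite_fibre_weighted_imp_finite[OF assms(2,3)] finite_subset by blast
  have eq: "quasi_periodic ?\<psi> \<alpha> \<longleftrightarrow> quasi_periodic \<phi> \<alpha>" "per ?\<psi> \<alpha> = per \<phi> \<alpha>" if "\<alpha> \<in> \<Lambda>" for \<alpha>
    using funpow_restrict[OF inv that] by (simp_all add: quasi_periodic_def per_def)
  have Per_eq: "Per \<Lambda> ?\<psi> \<inter> \<Lambda> = Per \<Gamma> \<phi> \<inter> \<Lambda>"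
    using funpow_restrict[OF inv] core_subset by (auto simp: Per_def)
  \<comment> \<open>Stated for any weight without zeros on \<Lambda>, to be used for
    \<open>restrict w \<Lambda>\<close> and for the constant 1: iterates on \<Lambda> are those of
    \<phi>, so the case distinctions coincide.\<close>
  have ent: "ent_cset (families \<Lambda>) (weighted_gen_shift \<Lambda> ?\<psi> v) =
      ent_cset (families \<Gamma>) (weighted_gen_shift \<Gamma> \<phi> w)"
    if "\<And>\<alpha>. \<alpha> \<in> \<Lambda> \<Longrightarrow> v \<alpha> \<noteq> 0" for v :: "'a \<Rightarrow> 'f"
  proof -
    have "weighted_shift \<Lambda> ?\<psi> v \<Lambda>"
      using inv that by (rule weighted_shift_restrict)
    from weighted_shift.ent_cset_cases[OF this] show ?thesis
      unfolding ent_cset_cases by (simp add: eq Per_eq cong: SUP_cong_simp)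
  qed
  have "ent_cset (families \<Lambda>) (weighted_gen_shift \<Lambda> ?\<psi> (restrict w \<Lambda>)) =
      ent_cset (families \<Gamma>) (weighted_gen_shift \<Gamma> \<phi> w)"
    by (rule ent) (simp add: nz)
  moreover have "ent_cset (families \<Lambda> :: ('a \<Rightarrow> 'f) set) (gen_shift \<Lambda> ?\<psi>) =
      ent_cset (families \<Gamma>) (weighted_gen_shift \<Gamma> \<phi> w)"
    unfolding gen_shift_eq_weighted by (rule ent) simp
  moreover have "finite_fibre (families \<Lambda>) (weighted_gen_shift \<Lambda> ?\<psi> (restrict w \<Lambda>))"
    by (rule finite_fibre_weighted[OF fin]) (simp add: nz)
  moreover have "finite_fibre (families \<Lambda> :: ('a \<Rightarrow> 'f) set) (gen_shift \<Lambda> ?\<psi>)"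
    unfolding gen_shift_eq_weighted by (rule finite_fibre_weighted[OF fin]) simp
  ultimately show ?thesis
    using inv by (intro conjI ent_cset_cases) simp_all
qed

end
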